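(* Let $X=(X,\rho,\mu)$ be a homogeneous space which supports the weak $p$-Poincaré inequality, let $\Omega,\widetilde\Omega\subset X$ be bounded domains, let $1<q\le p<\infty$, and let $\varphi:\Omega\to\widetilde\Omega$ be a bi-measurable homeomorphism generating a bounded composition operator $\varphi^*:S^{1,p}(\widetilde\Omega)\to S^{1,q}(\Omega)$, $\varphi^*(f)=f\circ\varphi$, i.e. $f\circ\varphi\in S^{1,q}(\Omega)$ and $\|f\circ\varphi\|_{S^{1,q}(\Omega)}\le C_{p,q}\|f\|_{S^{1,p}(\widetilde\Omega)}$ for all $f\in S^{1,p}(\widetilde\Omega)$, with a constant $C_{p,q}<\infty$ independent of $f$. Then, with this constant $C_{p,q}$, $$\mathrm{cap}_q^{1/q}(\varphi^{-1}(\widetilde E);\Omega)\le C_{p,q}\,\mathrm{cap}_p^{1/p}(\widetilde E;\widetilde\Omega)$$ for every Borel set $\widetilde E\subset\widetilde\Omega$.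
   Context: A doubling metric measure space is a metric space $(X,\rho)$ with a Borel regular measure $\mu$ for which every ball has positive finite measure and $\mu(B(x,2r))\le C_\mu\mu(B(x,r))$ for all $x\in X$, $r>0$, with a (smallest) constant $C_\mu\ge1$. A homogeneous space is a doubling metric measure space with $\sigma$-finite measure such that there is $c_1\ge1$ with: for all $x_1,x_2\in X$, $r>0$, if $B(x_1,r)\cap B(x_2,r)\ne\emptyset$ then $B(x_2,r)\subset B(x_1,c_1r)$. A domain is a nonempty connected open set. Bounded domains $\Omega\subset X$ are considered as doubling metric measure spaces with the metric and measure induced from $X$. For a family $\Gamma$ of curves, $\mathrm{mod}_p(\Gamma)=\inf\int\eta^p\,d\mu$ over Borel $\eta\ge0$ with $\int_\gamma\eta\,ds\ge1$ for all locally rectifiable $\gamma\in\Gamma$. A Borel function $g\ge 0$ is a $p$-weak upper gradient of $f$ if $|f(\gamma(a))-f(\gamma(b))|\le\int_\gamma g\,ds$ for all rectifiable curves $\gamma:[a,b]\to\Omega$ except a family of zero $p$-module; it is an upper gradient if this holds for all rectifiable curves. If there is a $p$-weak upper gradient in $L^p$, $\nabla_{min}f$ denotes the minimal $p$-weak upper gradient in $L^p$ (unique up to measure zero). $N^{1,p}(\Omega)$ is the space of measurable $f:\Omega\to\mathbb R$ with $f\in L^p(\Omega)$ having a $p$-weak upper gradient in $L^p(\Omega)$. $S^{1,p}(\Omega)$, $1<p<\infty$, is the space of measurable $f:\Omega\to\mathbb R$ with $f\in L^1_{loc}(\Omega)$ and $\nabla_{min}f\in L^p(\Omega)$, with seminorm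 $\|f\|_{S^{1,p}(\Omega)}=\|\nabla_{min}f\|_{L^p(\Omega)}$. Functions in these spaces are considered up to sets of $p$-capacity zero (quasicontinuous representatives are used). Weak $p$-Poincaré inequality: there are $\sigma>1$ and $C_p$ such that for all balls $B\subset X$, all $f\in L^1(\sigma B)$ and all $p$-weak upper gradients $g$ of $f$ in $\sigma B$, $\frac1{\mu(B)}\int_B|f-f_B|\,d\mu\le C_p\,\mathrm{diam}(B)\left(\frac1{\mu(\sigma B)}\int_{\sigma B}g^p\,d\mu\right)^{1/p}$, where $f_B$ is the mean of $f$ over $B$. A homeomorphism $\varphi:\Omega\to\widetilde\Omega$ is bi-measurable if images under $\varphi$ of sets of $\mu$-measure zero have $\mu$-measure zero (Luzin $N$-property) and preimages of sets of $\mu$-measure zero have $\mu$-measure zero (Luzin $N^{-1}$-property). Capacity: for compact $F\subset\Omega$, $\mathrm{cap}_p(F;\Omega)=\inf\int_\Omega(\nabla_{min}u)^p\,d\mu$ over $u\in C_0(\Omega)\cap N^{1,p}(\Omega)$ (with $C_0(\Omega)$ the continuous functions with compact support in $\Omega$) with $u\ge1$ on $F$. For open $U\subset \Omega$, $\mathrm{cap}_p(U;\Omega)$ is the supremum of $\mathrm{cap}_p(F;\Omega)$ over compact $F\subset U$. For arbitrary $E\subset\Omega$, the inner capacity is the supremum of $\mathrm{cap}_p(F;\Omega)$ over compact $F\subset E$ and the outer capacity is the infimum of $\mathrm{cap}_p(U;\Omega)$ over open $U$ with $E\subset U\subset\Omega$. If both agree, $E$ is called $p$-capacity measurable and the common value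 is $\mathrm{cap}_p(E;\Omega)$. Borel sets are $p$-capacity measurable. *)

theory Defs
  imports "HOL-Analysis.Analysis"
begin

definition epowr :: "ennreal \<Rightarrow> real \<Rightarrow> ennreal" where
  "epowr x p = (if x = top then top else ennreal (enn2real x powr p))"

(* Multiplication by a constant with C * \<infinity> = \<infinity> also for C = 0 (in ennreal 0 * \<infinity> = 0).
   A capacity may be \<infinity>, being an infimum over a possibly empty class; an upper bound by an
   infinite capacity is meant to be void. *)
definition escale :: "real \<Rightarrow> ennreal \<Rightarrow> ennreal" where
  "escale C x = (if x = top then top else ennreal C * x)"


section \<open>Homogeneous spaces\<close>

(* A Borel regular measure is represented by its restriction M to the Borel sets; by Borel
   regularity its measurable sets and its null sets are those of completion M. *)
definition doubling_space :: "'a::metric_space measure \<Rightarrow> bool" where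
  "doubling_space M \<longleftrightarrow>
     sets M = sets borel \<and>
     (\<forall>x r. r > 0 \<longrightarrow> 0 < emeasure M (ball x r) \<and> emeasure M (ball x r) < top) \<and>
     (\<exists>C\<ge>1. \<forall>x r. r > 0 \<longrightarrow>
        emeasure M (ball x (2 * r)) \<le> ennreal C * emeasure M (ball x r))"

definition homogeneous_space :: "'a::metric_space measure \<Rightarrow> bool" where
  "homogeneous_space M \<longleftrightarrow>
     doubling_space M \<and> sigma_finite_measure M \<and>
     (\<exists>c\<ge>1. \<forall>(x1::'a) x2 r. r > 0 \<longrightarrow> ball x1 r \<inter> ball x2 r \<noteq> {} \<longrightarrow>
        ball x2 r \<subseteq> ball x1 (c * r))"

definition bounded_domain :: "'a::metric_space set \<Rightarrow> bool" where
  "bounded_domain \<Omega> \<longleftrightarrow> open \<Omega> \<and> connected \<Omega> \<and> \<Omega> \<noteq> {} \<and> bounded \<Omega>"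


section \<open>Curves and modulus\<close>

(* (a, b, \<gamma>) stands for the curve \<gamma> : [a,b] \<rightarrow> X; values of \<gamma> off [a,b] are irrelevant. *)
type_synonym 'a curve = "real \<times> real \<times> (real \<Rightarrow> 'a)"

definition curves_in :: "'a::metric_space set \<Rightarrow> 'a curve set" where
  "curves_in U = {(a, b, \<gamma>). a \<le> b \<and> continuous_on {a..b} \<gamma> \<and> \<gamma> ` {a..b} \<subseteq> U}"

definition curve_length :: "real \<Rightarrow> real \<Rightarrow> (real \<Rightarrow> 'a::metric_space) \<Rightarrow> ennreal" where
  "curve_length a b \<gamma> =
     (SUP ts \<in> {ts. sorted ts \<and> set ts \<subseteq> {a..b}}.
        \<Sum>i<length ts - 1. ennreal (dist (\<gamma> (ts ! i)) (\<gamma> (ts ! Suc i))))"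

definition rectifiable :: "'a::metric_space curve \<Rightarrow> bool" where
  "rectifiable = (\<lambda>(a, b, \<gamma>). curve_length a b \<gamma> < top)"

(* Arc length parametrization on [0, length]: \<gamma> is constant on the set of all t in [a,b] for
   which the length of \<gamma> on [a,t] is s, so the choice of t does not matter. *)
definition arc_param :: "real \<Rightarrow> real \<Rightarrow> (real \<Rightarrow> 'a::metric_space) \<Rightarrow> real \<Rightarrow> 'a" where
  "arc_param a b \<gamma> s = \<gamma> (SOME t. t \<in> {a..b} \<and> curve_length a t \<gamma> = ennreal s)"

definition line_integral :: "('a::metric_space \<Rightarrow> ennreal) \<Rightarrow> 'a curve \<Rightarrow> ennreal" where
  "line_integral g = (\<lambda>(a, b, \<gamma>).
     \<integral>\<^sup>+s\<in>{0..enn2real (curve_length a b \<gamma>)}. g (arc_param a b \<gamma> s) \<partial>lborel)"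

(* Modulus in the metric measure space U. All curves here have a compact parameter interval,
   so that locally rectifiable means rectifiable. *)
definition modulus :: "'a::metric_space measure \<Rightarrow> real \<Rightarrow> 'a set \<Rightarrow> 'a curve set \<Rightarrow> ennreal" where
  "modulus M p U \<Gamma> =
     (INF \<eta> \<in> {\<eta> \<in> borel_measurable (restrict_space borel U).
                 \<forall>c\<in>\<Gamma>. rectifiable c \<longrightarrow> 1 \<le> line_integral \<eta> c}.
        \<integral>\<^sup>+x\<in>U. epowr (\<eta> x) p \<partial>M)"


section \<open>Weak upper gradients and Sobolev spaces\<close>

(* A function on a subset U of X is represented by a function on X, of which only the values
   on U matter. *)

definition weak_upper_gradient ::
  "'a::metric_space measure \<Rightarrow> real \<Rightarrow> 'a set \<Rightarrow> ('a \<Rightarrow> real) \<Rightarrow> ('a \<Rightarrow> ennreal) \<Rightarrow> bool" where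
  "weak_upper_gradient M p U f g \<longleftrightarrow>
     g \<in> borel_measurable (restrict_space borel U) \<and>
     (\<exists>\<Gamma> \<subseteq> curves_in U. modulus M p U \<Gamma> = 0 \<and>
        (\<forall>a b \<gamma>. (a, b, \<gamma>) \<in> curves_in U - \<Gamma> \<and> rectifiable (a, b, \<gamma>) \<longrightarrow>
           ennreal \<bar>f (\<gamma> a) - f (\<gamma> b)\<bar> \<le> line_integral g (a, b, \<gamma>)))"

definition weak_upper_gradient_Lp ::
  "'a::metric_space measure \<Rightarrow> real \<Rightarrow> 'a set \<Rightarrow> ('a \<Rightarrow> real) \<Rightarrow> ('a \<Rightarrow> ennreal) \<Rightarrow> bool" where
  "weak_upper_gradient_Lp M p U f g \<longleftrightarrow>
     weak_upper_gradient M p U f g \<and> (\<integral>\<^sup>+x\<in>U. epowr (g x) p \<partial>M) < top"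

definition is_minimal_gradient ::
  "'a::metric_space measure \<Rightarrow> real \<Rightarrow> 'a set \<Rightarrow> ('a \<Rightarrow> real) \<Rightarrow> ('a \<Rightarrow> ennreal) \<Rightarrow> bool" where
  "is_minimal_gradient M p U f g \<longleftrightarrow>
     weak_upper_gradient_Lp M p U f g \<and>
     (\<forall>h. weak_upper_gradient_Lp M p U f h \<longrightarrow> (AE x in M. x \<in> U \<longrightarrow> g x \<le> h x))"

(* Determined up to null sets. *)
definition grad_min ::
  "'a::metric_space measure \<Rightarrow> real \<Rightarrow> 'a set \<Rightarrow> ('a \<Rightarrow> real) \<Rightarrow> 'a \<Rightarrow> ennreal" where
  "grad_min M p U f = (SOME g. is_minimal_gradient M p U f g)"

definition energy :: "'a::metric_space measure \<Rightarrow> real \<Rightarrow> 'a set \<Rightarrow> ('a \<Rightarrow> real) \<Rightarrow> ennreal" where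
  "energy M p U f = (\<integral>\<^sup>+x\<in>U. epowr (grad_min M p U f x) p \<partial>M)"

definition S_seminorm :: "'a::metric_space measure \<Rightarrow> real \<Rightarrow> 'a set \<Rightarrow> ('a \<Rightarrow> real) \<Rightarrow> ennreal" where
  "S_seminorm M p U f = epowr (energy M p U f) (1 / p)"

definition L1_loc :: "'a::metric_space measure \<Rightarrow> 'a set \<Rightarrow> ('a \<Rightarrow> real) set" where
  "L1_loc M U = {f. \<forall>x\<in>U. \<exists>r>0. set_integrable (completion M) (ball x r \<inter> U) f}"

(* The members of N_space and S_space are pointwise defined functions, not equivalence classes. *)

definition N_space :: "'a::metric_space measure \<Rightarrow> real \<Rightarrow> 'a set \<Rightarrow> ('a \<Rightarrow> real) set" where
  "N_space M p U =
     {f. f \<in> borel_measurable (restrict_space (completion M) U) \<and>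
         (\<integral>\<^sup>+x\<in>U. ennreal (\<bar>f x\<bar> powr p) \<partial>completion M) < top \<and>
         (\<exists>g. weak_upper_gradient_Lp M p U f g)}"

definition S_space :: "'a::metric_space measure \<Rightarrow> real \<Rightarrow> 'a set \<Rightarrow> ('a \<Rightarrow> real) set" where
  "S_space M p U =
     {f. f \<in> borel_measurable (restrict_space (completion M) U) \<and>
         f \<in> L1_loc M U \<and>
         (\<exists>g. weak_upper_gradient_Lp M p U f g)}"

(* For diam B = 0 the ball is a point and both sides vanish. *)
definition supports_weak_Poincare :: "'a::metric_space measure \<Rightarrow> real \<Rightarrow> bool" where
  "supports_weak_Poincare M p \<longleftrightarrow>
     (\<exists>\<sigma>>1. \<exists>C>0. \<forall>x r f g. r > 0 \<longrightarrow>
        set_integrable (completion M) (ball x (\<sigma> * r)) f \<longrightarrow>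
        weak_upper_gradient M p (ball x (\<sigma> * r)) f g \<longrightarrow>
        (let m = (LINT y:ball x r|completion M. f y) / measure M (ball x r) in
          (\<integral>\<^sup>+y\<in>ball x r. ennreal \<bar>f y - m\<bar> \<partial>completion M) / emeasure M (ball x r)
            \<le> ennreal (C * diameter (ball x r)) *
              epowr ((\<integral>\<^sup>+y\<in>ball x (\<sigma> * r). epowr (g y) p \<partial>M)
                       / emeasure M (ball x (\<sigma> * r))) (1 / p)))"


section \<open>Capacity\<close>

definition C0 :: "'a::metric_space set \<Rightarrow> ('a \<Rightarrow> real) set" where
  "C0 \<Omega> = {u. continuous_on \<Omega> u \<and> compact (\<Omega> \<inter> closure {x \<in> \<Omega>. u x \<noteq> 0})}"

definition cap_compact :: "'a::metric_space measure \<Rightarrow> real \<Rightarrow> 'a set \<Rightarrow> 'a set \<Rightarrow> ennreal" where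
  "cap_compact M p \<Omega> F =
     (INF u \<in> {u \<in> C0 \<Omega> \<inter> N_space M p \<Omega>. \<forall>x\<in>F. 1 \<le> u x}. energy M p \<Omega> u)"

definition cap_inner :: "'a::metric_space measure \<Rightarrow> real \<Rightarrow> 'a set \<Rightarrow> 'a set \<Rightarrow> ennreal" where
  "cap_inner M p \<Omega> E = (SUP F \<in> {F. compact F \<and> F \<subseteq> E}. cap_compact M p \<Omega> F)"

definition cap_open :: "'a::metric_space measure \<Rightarrow> real \<Rightarrow> 'a set \<Rightarrow> 'a set \<Rightarrow> ennreal" where
  "cap_open M p \<Omega> U = (SUP F \<in> {F. compact F \<and> F \<subseteq> U}. cap_compact M p \<Omega> F)"

definition cap_outer :: "'a::metric_space measure \<Rightarrow> real \<Rightarrow> 'a set \<Rightarrow> 'a set \<Rightarrow> ennreal" where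
  "cap_outer M p \<Omega> E = (INF U \<in> {U. open U \<and> E \<subseteq> U \<and> U \<subseteq> \<Omega>}. cap_open M p \<Omega> U)"

definition cap_measurable :: "'a::metric_space measure \<Rightarrow> real \<Rightarrow> 'a set \<Rightarrow> 'a set \<Rightarrow> bool" where
  "cap_measurable M p \<Omega> E \<longleftrightarrow> cap_inner M p \<Omega> E = cap_outer M p \<Omega> E"

(* Meaningful only for capacity measurable sets. *)
definition cap :: "'a::metric_space measure \<Rightarrow> real \<Rightarrow> 'a set \<Rightarrow> 'a set \<Rightarrow> ennreal" where
  "cap M p \<Omega> E = (THE c. c = cap_inner M p \<Omega> E \<and> c = cap_outer M p \<Omega> E)"

definition quasicontinuous :: "'a::metric_space measure \<Rightarrow> real \<Rightarrow> 'a set \<Rightarrow> ('a \<Rightarrow> real) \<Rightarrow> bool" where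
  "quasicontinuous M p \<Omega> f \<longleftrightarrow>
     (\<forall>\<epsilon>>0. \<exists>U. open U \<and> U \<subseteq> \<Omega> \<and> cap_open M p \<Omega> U < ennreal \<epsilon> \<and> continuous_on (\<Omega> - U) f)"


section \<open>Bi-measurable homeomorphisms and composition operators\<close>

definition bimeasurable_homeo ::
  "'a::metric_space measure \<Rightarrow> 'a set \<Rightarrow> 'a set \<Rightarrow> ('a \<Rightarrow> 'a) \<Rightarrow> bool" where
  "bimeasurable_homeo M \<Omega> \<Omega>' \<phi> \<longleftrightarrow>
     (\<exists>\<psi>. homeomorphism \<Omega> \<Omega>' \<phi> \<psi>) \<and>
     (\<forall>N \<subseteq> \<Omega>. N \<in> null_sets (completion M) \<longrightarrow> \<phi> ` N \<in> null_sets (completion M)) \<and>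
     (\<forall>N \<subseteq> \<Omega>'. N \<in> null_sets (completion M) \<longrightarrow> \<phi> -` N \<inter> \<Omega> \<in> null_sets (completion M))"

(* The classes in S^{1,p} modulo p-capacity zero are represented by quasicontinuous functions,
   so only these are composed with \<phi>. *)
definition bounded_composition ::
  "'a::metric_space measure \<Rightarrow> real \<Rightarrow> real \<Rightarrow> 'a set \<Rightarrow> 'a set \<Rightarrow> ('a \<Rightarrow> 'a) \<Rightarrow> real \<Rightarrow> bool" where
  "bounded_composition M p q \<Omega> \<Omega>' \<phi> C \<longleftrightarrow>
     (\<forall>f \<in> S_space M p \<Omega>'. quasicontinuous M p \<Omega>' f \<longrightarrow>
        f \<circ> \<phi> \<in> S_space M q \<Omega> \<and>
        S_seminorm M q \<Omega> (f \<circ> \<phi>) \<le> ennreal C * S_seminorm M p \<Omega>' f)"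

end

theory Submission
  imports Defs
begin

text \<open>The admissible functions for the capacity of a compact set \<open>F \<subseteq> \<Omega>'\<close> are continuous with compact
  support in a bounded domain. Such a function \<open>u\<close> is bounded on a set of finite measure, so it lies
  in \<open>S\<^sup>1\<^sup>,\<^sup>p(\<Omega>')\<close>, and it is its own quasicontinuous representative; hence the composition operator
  applies to it (\<open>admissible_composition\<close>). As \<open>\<phi>\<close> is a homeomorphism, \<open>u \<circ> \<phi>\<close> is again continuous
  with compact support (\<open>C0_comp_homeomorphism\<close>), and by boundedness it lies in \<open>N\<^sup>1\<^sup>,\<^sup>q(\<Omega>)\<close>. So
  \<open>u \<circ> \<phi>\<close> is admissible for the compact set \<open>\<phi>\<^sup>-\<^sup>1(F)\<close>, and its energy is controlled by that of \<open>u\<close>.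
  The infimum over \<open>u\<close> gives the inequality for compact sets (\<open>cap_compact_vimage_le\<close>).

  Since \<open>\<phi>\<close> gives bijections between the compact subsets of \<open>E\<close> and those of its preimage, and
  between the open neighbourhoods of these sets, the inequality passes to suprema (inner
  capacities and open sets) and then to infima (outer capacities). The passage is a matter of
  order theory only: powers on \<open>[0,\<infinity>]\<close> commute with suprema and infima (\<open>epowr_le_iff\<close>), and an upper
  bound by multiples passes to the infimum (\<open>le_escale_INF\<close>).\<close>

section \<open>Powers and multiples of extended nonnegative reals\<close>

lemma epowr_mono: "0 < r \<Longrightarrow> x \<le> y \<Longrightarrow> epowr x r \<le> epowr y r"
  by (cases x; cases y) (auto simp: epowr_def top_unique intro!: ennreal_leI powr_mono2)

lemma epowr_inverse: "0 < r \<Longrightarrow> epowr (epowr x r) (1 / r) = x"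
  by (cases x) (auto simp: epowr_def powr_powr)

lemma epowr_inverse': "0 < r \<Longrightarrow> epowr (epowr x (1 / r)) r = x"
  using epowr_inverse[of "1 / r" x] by simp

lemma epowr_0 [simp]: "epowr 0 r = 0"
  by (simp add: epowr_def)

text \<open>The Galois connection between a power and its inverse power; it yields that powers commute
  with suprema and infima.\<close>

lemma epowr_le_iff:
  assumes "0 < r"
  shows "epowr x r \<le> y \<longleftrightarrow> x \<le> epowr y (1 / r)"
proof
  assume "epowr x r \<le> y"
  then have "epowr (epowr x r) (1 / r) \<le> epowr y (1 / r)"
    using assms by (intro epowr_mono) auto
  then show "x \<le> epowr y (1 / r)" using assms by (simp add: epowr_inverse)
next
  assume "x \<le> epowr y (1 / r)"
  then have "epowr x r \<le> epowr (epowr y (1 / r)) r"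
    using assms by (intro epowr_mono) auto
  then show "epowr x r \<le> y" using assms by (simp add: epowr_inverse')
qed

lemma epowr_SUP:
  assumes "0 < r"
  shows "epowr (SUP i\<in>I. f i) r = (SUP i\<in>I. epowr (f i) r)"
proof (rule antisym)
  show "epowr (SUP i\<in>I. f i) r \<le> (SUP i\<in>I. epowr (f i) r)"
    unfolding epowr_le_iff[OF assms]
    by (rule SUP_least) (auto simp: epowr_le_iff[OF assms, symmetric] intro: SUP_upper)
  show "(SUP i\<in>I. epowr (f i) r) \<le> epowr (SUP i\<in>I. f i) r"
    by (rule SUP_least) (auto intro!: epowr_mono assms SUP_upper)
qed

lemma epowr_INF:
  assumes "0 < r"
  shows "epowr (INF i\<in>I. f i) r = (INF i\<in>I. epowr (f i) r)"
proof (rule antisym)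
  show "epowr (INF i\<in>I. f i) r \<le> (INF i\<in>I. epowr (f i) r)"
    by (rule INF_greatest) (auto intro!: epowr_mono assms INF_lower)
  have le_iff: "x \<le> epowr y r \<longleftrightarrow> epowr x (1 / r) \<le> y" for x y
    using epowr_le_iff[of "1 / r" x y] assms by simp
  show "(INF i\<in>I. epowr (f i) r) \<le> epowr (INF i\<in>I. f i) r"
    unfolding le_iff
    by (rule INF_greatest) (auto simp: le_iff[symmetric] intro: INF_lower)
qed

lemma mult_le_escale: "ennreal C * x \<le> escale C x"
  by (simp add: escale_def)

lemma escale_mono: "x \<le> y \<Longrightarrow> escale C x \<le> escale C y"
  by (auto simp: escale_def top_unique intro: mult_left_mono)

text \<open>If every \<open>f i\<close> is infinite, in particular if the family is empty, the bound for \<open>C = 0\<close> rests on the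
  convention \<open>0 \<cdot> \<infinity> = \<infinity>\<close> of \<open>escale\<close>. For \<open>C > 0\<close> division by \<open>C\<close> is adjoint to multiplication.\<close>

lemma le_escale_INF:
  assumes "0 \<le> C" and le: "\<And>i. i \<in> I \<Longrightarrow> x \<le> escale C (f i)"
  shows "x \<le> escale C (INF i\<in>I. f i)"
proof (cases "(INF i\<in>I. f i) = top")
  case True
  then show ?thesis by (simp add: escale_def)
next
  case False
  then obtain j where j: "j \<in> I" "f j \<noteq> top"
    by (metis INF_eqI top_greatest top_unique)
  show ?thesis
  proof (cases "C = 0")
    case True
    then show ?thesis using le[OF j(1)] j(2) by (simp add: escale_def)
  next
    case C: False
    have "x / ennreal C \<le> f i" if "i \<in> I" for i
    proof (cases "f i = top")
      case False
      then show ?thesis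
        using le[OF that] C assms(1)
        by (simp add: escale_def divide_le_posI_ennreal ac_simps)
    qed simp
    then have "x / ennreal C \<le> (INF i\<in>I. f i)" by (rule INF_greatest)
    then have "x / ennreal C * ennreal C \<le> (INF i\<in>I. f i) * ennreal C"
      by (rule mult_right_mono) simp
    moreover have "x / ennreal C * ennreal C = x"
      using C assms(1) by (simp add: ennreal_divide_times)
    ultimately show ?thesis
      using mult_le_escale[of C "INF i\<in>I. f i"] by (auto simp: ac_simps intro: order_trans)
  qed
qed

lemma bound_INF:
  assumes "0 < p" "0 \<le> C" "\<And>i. i \<in> I \<Longrightarrow> x \<le> escale C (epowr (f i) (1 / p))"
  shows "x \<le> escale C (epowr (INF i\<in>I. f i) (1 / p))"
  using assms by (simp add: epowr_INF le_escale_INF)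

lemma bound_SUP_SUP:
  assumes "0 < p" "0 < q"
    and "\<And>i. i \<in> I \<Longrightarrow> \<exists>j\<in>J. epowr (f i) (1 / q) \<le> escale C (epowr (g j) (1 / p))"
  shows "epowr (SUP i\<in>I. f i) (1 / q) \<le> escale C (epowr (SUP j\<in>J. g j) (1 / p))"
proof -
  have "epowr (f i) (1 / q) \<le> escale C (epowr (SUP j\<in>J. g j) (1 / p))" if "i \<in> I" for i
  proof -
    obtain j where j: "j \<in> J" "epowr (f i) (1 / q) \<le> escale C (epowr (g j) (1 / p))"
      using assms(3)[OF \<open>i \<in> I\<close>] by blast
    note j(2)
    also have "escale C (epowr (g j) (1 / p)) \<le> escale C (epowr (SUP j\<in>J. g j) (1 / p))"
      using assms j(1) by (intro escale_mono epowr_mono SUP_upper) auto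
    finally show ?thesis .
  qed
  then show ?thesis
    using assms by (simp add: epowr_SUP SUP_least)
qed

section \<open>Continuous functions with compact support\<close>

lemma C0_bounded:
  assumes "u \<in> C0 \<Omega>"
  obtains B where "0 \<le> B" "\<And>x. x \<in> \<Omega> \<Longrightarrow> \<bar>u x\<bar> \<le> B"
proof -
  define K where "K = \<Omega> \<inter> closure {x \<in> \<Omega>. u x \<noteq> 0}"
  have "compact K" "continuous_on \<Omega> u"
    using assms by (auto simp: C0_def K_def)
  then have "bounded (u ` K)"
    using continuous_on_subset[of \<Omega> u K]
    by (intro compact_imp_bounded compact_continuous_image) (auto simp: K_def)
  then obtain B where B: "0 < B" "\<And>x. x \<in> K \<Longrightarrow> \<bar>u x\<bar> \<le> B"
    unfolding bounded_pos by auto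
  have "\<bar>u x\<bar> \<le> B" if "x \<in> \<Omega>" for x
  proof (cases "u x = 0")
    case False
    then have "x \<in> K"
      using that closure_subset[of "{x \<in> \<Omega>. u x \<noteq> 0}"] by (auto simp: K_def)
    then show ?thesis by (rule B)
  qed (use B in auto)
  then show ?thesis using that[of B] B by simp
qed

text \<open>The support of the composition lies in the image of the support of \<open>u\<close> under the inverse
  map, which is compact and contained in the domain.\<close>

lemma C0_comp_homeomorphism:
  assumes hom: "homeomorphism \<Omega> \<Omega>' \<phi> \<psi>" and u: "u \<in> C0 \<Omega>'"
  shows "u \<circ> \<phi> \<in> C0 \<Omega>"
proof -
  define K where "K = \<Omega>' \<inter> closure {y \<in> \<Omega>'. u y \<noteq> 0}"
  define S where "S = {x \<in> \<Omega>. (u \<circ> \<phi>) x \<noteq> 0}"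
  have "compact K" and u_cont: "continuous_on \<Omega>' u"
    using u by (auto simp: C0_def K_def)
  have "compact (\<psi> ` K)"
    using hom \<open>compact K\<close> continuous_on_subset[of \<Omega>' \<psi> K]
    by (intro compact_continuous_image) (auto simp: K_def homeomorphism_def)
  have "\<psi> ` K \<subseteq> \<Omega>"
    using hom by (auto simp: K_def homeomorphism_def)
  have "S \<subseteq> \<psi> ` K"
  proof
    fix x assume "x \<in> S"
    then have "\<phi> x \<in> K" "\<psi> (\<phi> x) = x"
      using hom closure_subset[of "{y \<in> \<Omega>'. u y \<noteq> 0}"]
      by (auto simp: S_def K_def homeomorphism_def)
    then show "x \<in> \<psi> ` K" by (metis image_eqI)
  qed
  then have "closure S \<subseteq> \<psi> ` K"
    using \<open>compact (\<psi> ` K)\<close> by (simp add: closure_minimal compact_imp_closed)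
  then have "\<Omega> \<inter> closure S = \<psi> ` K \<inter> closure S"
    using \<open>\<psi> ` K \<subseteq> \<Omega>\<close> by auto
  then have "compact (\<Omega> \<inter> closure S)"
    using \<open>compact (\<psi> ` K)\<close> by (simp add: compact_Int_closed)
  moreover have "continuous_on \<Omega> (u \<circ> \<phi>)"
    using hom u_cont by (intro continuous_on_compose) (auto simp: homeomorphism_def)
  ultimately show ?thesis by (simp add: C0_def S_def)
qed

section \<open>Bounded functions on bounded domains\<close>

lemma doubling_space_emeasure_finite:
  assumes "doubling_space M" "bounded U"
  shows "emeasure (completion M) U < top"
proof -
  obtain x r where xr: "0 < r" "U \<subseteq> ball x r"
    using assms(2) by (metis bounded_subset_ballD)
  have "ball x r \<in> sets M" and fin: "emeasure M (ball x r) < top"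
    using assms(1) xr by (auto simp: doubling_space_def)
  then have "emeasure (completion M) U \<le> emeasure (completion M) (ball x r)"
    using xr by (intro emeasure_mono) auto
  also have "\<dots> < top" using fin \<open>ball x r \<in> sets M\<close> by simp
  finally show ?thesis .
qed

lemma doubling_space_open_sets:
  "doubling_space M \<Longrightarrow> open U \<Longrightarrow> U \<in> sets (completion M)"
  by (simp add: doubling_space_def sets_completionI_sets)

lemma bounded_function_L1_loc:
  assumes M: "doubling_space M" and U: "open U" "bounded U"
    and f: "f \<in> borel_measurable (restrict_space (completion M) U)"
    and B: "\<And>x. x \<in> U \<Longrightarrow> \<bar>f x\<bar> \<le> B"
  shows "f \<in> L1_loc M U"
proof -
  have "set_integrable (completion M) (ball x 1 \<inter> U) f" for x
  proof -
    let ?A = "ball x 1 \<inter> U"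
    have meas: "(\<lambda>y. indicator U y *\<^sub>R f y) \<in> borel_measurable (completion M)"
      using f borel_measurable_restrict_space_iff[of U "completion M" f]
        doubling_space_open_sets[OF M U(1)] by auto
    have "integrable (completion M) (\<lambda>y. indicator ?A y *\<^sub>R (indicator U y *\<^sub>R f y))"
    proof (rule integrableI_bounded_set_indicator[OF _ meas])
      show "?A \<in> sets (completion M)"
        using U by (intro doubling_space_open_sets[OF M]) auto
      show "emeasure (completion M) ?A < \<infinity>"
        using doubling_space_emeasure_finite[OF M, of ?A] U by (simp add: bounded_Int)
      show "AE y in completion M. y \<in> ?A \<longrightarrow> norm (indicator U y *\<^sub>R f y) \<le> B"
        using B by (auto simp: indicator_def)
    qed
    also have "(\<lambda>y. indicator ?A y *\<^sub>R (indicator U y *\<^sub>R f y)) = (\<lambda>y. indicator ?A y *\<^sub>R f y)"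
      by (auto simp: indicator_def)
    finally show ?thesis by (simp add: set_integrable_def)
  qed
  then show ?thesis by (auto simp: L1_loc_def intro: exI[of _ 1])
qed

lemma bounded_function_Lp:
  assumes M: "doubling_space M" and U: "open U" "bounded U" and p: "0 < p"
    and B: "\<And>x. x \<in> U \<Longrightarrow> \<bar>f x\<bar> \<le> B"
  shows "(\<integral>\<^sup>+x\<in>U. ennreal (\<bar>f x\<bar> powr p) \<partial>completion M) < top"
proof -
  have "(\<integral>\<^sup>+x\<in>U. ennreal (\<bar>f x\<bar> powr p) \<partial>completion M)
      \<le> (\<integral>\<^sup>+x. ennreal (B powr p) * indicator U x \<partial>completion M)"
    using B p by (intro nn_integral_mono) (auto simp: indicator_def intro!: ennreal_leI powr_mono2)
  also have "\<dots> = ennreal (B powr p) * emeasure (completion M) U"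
    using doubling_space_open_sets[OF M U(1)] by (rule nn_integral_cmult_indicator)
  also have "\<dots> < top"
    using doubling_space_emeasure_finite[OF M U(2)] by (simp add: ennreal_mult_less_top)
  finally show ?thesis .
qed

section \<open>Quasicontinuity of continuous functions\<close>

lemma weak_upper_gradient_zero:
  "weak_upper_gradient_Lp M p U (\<lambda>_. 0) (\<lambda>_. 0)"
proof -
  have "modulus M p U {} \<le> (\<integral>\<^sup>+x\<in>U. epowr 0 p \<partial>M)"
    unfolding modulus_def by (intro INF_lower2[of "\<lambda>_. 0"]) auto
  then have "modulus M p U {} = 0" by simp
  then show ?thesis
    by (auto simp: weak_upper_gradient_Lp_def weak_upper_gradient_def intro!: exI[of _ "{}"])
qed

text \<open>The constant \<open>0\<close> is a minimal weak upper gradient of the zero function, so the one that \<open>grad_min\<close>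
  selects vanishes almost everywhere.\<close>

lemma energy_zero: "energy M p U (\<lambda>_. 0) = 0"
proof -
  have "is_minimal_gradient M p U (\<lambda>_. 0) (\<lambda>_. 0)"
    using weak_upper_gradient_zero by (auto simp: is_minimal_gradient_def)
  then have "is_minimal_gradient M p U (\<lambda>_. 0) (grad_min M p U (\<lambda>_. 0))"
    unfolding grad_min_def by (rule someI[of "is_minimal_gradient M p U (\<lambda>_. 0)"])
  then have "AE x in M. x \<in> U \<longrightarrow> grad_min M p U (\<lambda>_. 0) x \<le> 0"
    unfolding is_minimal_gradient_def using weak_upper_gradient_zero by blast
  then have "energy M p U (\<lambda>_. 0) = (\<integral>\<^sup>+x. 0 \<partial>M)"
    unfolding energy_def by (intro nn_integral_cong_AE) (auto simp: indicator_def)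
  then show ?thesis by simp
qed

lemma cap_open_empty: "cap_open M p \<Omega> {} = 0"
proof -
  have "(\<lambda>_. 0) \<in> C0 \<Omega> \<inter> N_space M p \<Omega>"
    using weak_upper_gradient_zero by (auto simp: C0_def N_space_def)
  then have "cap_compact M p \<Omega> {} \<le> energy M p \<Omega> (\<lambda>_. 0)"
    unfolding cap_compact_def by (intro INF_lower) auto
  then show ?thesis by (auto simp: cap_open_def energy_zero)
qed

text \<open>The empty set can serve as the exceptional open set because its capacity is zero.\<close>

lemma continuous_imp_quasicontinuous:
  "continuous_on \<Omega> f \<Longrightarrow> quasicontinuous M p \<Omega> f"
  unfolding quasicontinuous_def by (auto intro!: exI[of _ "{}"] simp: cap_open_empty)

section \<open>Composition operators and capacities\<close>

text \<open>Membership of \<open>u \<circ> \<phi>\<close> in \<open>S\<^sup>1\<^sup>,\<^sup>q\<close> gives measurability and a weak upper gradient, but not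
  integrability to the power \<open>q\<close>; that comes from boundedness.\<close>

lemma admissible_composition:
  assumes M: "doubling_space M" and \<Omega>: "bounded_domain \<Omega>" and \<Omega>': "bounded_domain \<Omega>'"
    and q: "0 < q" and hom: "homeomorphism \<Omega> \<Omega>' \<phi> \<psi>"
    and comp: "bounded_composition M p q \<Omega> \<Omega>' \<phi> C"
    and u: "u \<in> C0 \<Omega>' \<inter> N_space M p \<Omega>'"
  shows "u \<circ> \<phi> \<in> C0 \<Omega> \<inter> N_space M q \<Omega>"
    and "epowr (energy M q \<Omega> (u \<circ> \<phi>)) (1 / q) \<le> ennreal C * epowr (energy M p \<Omega>' u) (1 / p)"
proof -
  obtain B where B: "\<And>y. y \<in> \<Omega>' \<Longrightarrow> \<bar>u y\<bar> \<le> B"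
    using u C0_bounded by blast
  have "u \<in> L1_loc M \<Omega>'"
    using \<Omega>' u B
    by (intro bounded_function_L1_loc[OF M]) (auto simp: bounded_domain_def N_space_def)
  then have "u \<in> S_space M p \<Omega>'"
    using u by (auto simp: S_space_def N_space_def)
  moreover have "quasicontinuous M p \<Omega>' u"
    using u by (auto simp: C0_def intro: continuous_imp_quasicontinuous)
  ultimately have S: "u \<circ> \<phi> \<in> S_space M q \<Omega>"
    and "S_seminorm M q \<Omega> (u \<circ> \<phi>) \<le> ennreal C * S_seminorm M p \<Omega>' u"
    using comp by (auto simp: bounded_composition_def)
  then show "epowr (energy M q \<Omega> (u \<circ> \<phi>)) (1 / q) \<le> ennreal C * epowr (energy M p \<Omega>' u) (1 / p)"
    by (simp add: S_seminorm_def)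
  have "\<bar>(u \<circ> \<phi>) x\<bar> \<le> B" if "x \<in> \<Omega>" for x
    using B hom that by (auto simp: homeomorphism_def)
  then have "(\<integral>\<^sup>+x\<in>\<Omega>. ennreal (\<bar>(u \<circ> \<phi>) x\<bar> powr q) \<partial>completion M) < top"
    using \<Omega> q by (intro bounded_function_Lp[OF M]) (auto simp: bounded_domain_def)
  then have "u \<circ> \<phi> \<in> N_space M q \<Omega>"
    using S by (auto simp: S_space_def N_space_def)
  then show "u \<circ> \<phi> \<in> C0 \<Omega> \<inter> N_space M q \<Omega>"
    using C0_comp_homeomorphism[OF hom] u by auto
qed

lemma cap_compact_vimage_le:
  assumes M: "doubling_space M" and \<Omega>: "bounded_domain \<Omega>" and \<Omega>': "bounded_domain \<Omega>'"
    and pq: "0 < p" "0 < q" and C: "0 \<le> C" and hom: "homeomorphism \<Omega> \<Omega>' \<phi> \<psi>"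
    and comp: "bounded_composition M p q \<Omega> \<Omega>' \<phi> C"
  shows "epowr (cap_compact M q \<Omega> (\<phi> -` F \<inter> \<Omega>)) (1 / q)
    \<le> escale C (epowr (cap_compact M p \<Omega>' F) (1 / p))"
  unfolding cap_compact_def[of M p]
proof (rule bound_INF[OF pq(1) C])
  fix u assume u: "u \<in> {u \<in> C0 \<Omega>' \<inter> N_space M p \<Omega>'. \<forall>x\<in>F. 1 \<le> u x}"
  then have u': "u \<in> C0 \<Omega>' \<inter> N_space M p \<Omega>'" by simp
  note adm = admissible_composition[OF M \<Omega> \<Omega>' pq(2) hom comp u']
  have "cap_compact M q \<Omega> (\<phi> -` F \<inter> \<Omega>) \<le> energy M q \<Omega> (u \<circ> \<phi>)"
    unfolding cap_compact_def using adm(1) u by (intro INF_lower) auto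
  then have "epowr (cap_compact M q \<Omega> (\<phi> -` F \<inter> \<Omega>)) (1 / q)
      \<le> epowr (energy M q \<Omega> (u \<circ> \<phi>)) (1 / q)"
    using pq by (intro epowr_mono) auto
  also note adm(2)
  also note mult_le_escale
  finally show "epowr (cap_compact M q \<Omega> (\<phi> -` F \<inter> \<Omega>)) (1 / q)
      \<le> escale C (epowr (energy M p \<Omega>' u) (1 / p))" .
qed

text \<open>Every compact subset of the preimage of \<open>E\<close> is the preimage of its image, a compact subset
  of \<open>E\<close>.\<close>

lemma cap_inner_vimage_le:
  assumes M: "doubling_space M" and \<Omega>: "bounded_domain \<Omega>" and \<Omega>': "bounded_domain \<Omega>'"
    and pq: "0 < p" "0 < q" and C: "0 \<le> C" and hom: "homeomorphism \<Omega> \<Omega>' \<phi> \<psi>"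
    and comp: "bounded_composition M p q \<Omega> \<Omega>' \<phi> C"
  shows "epowr (cap_inner M q \<Omega> (\<phi> -` E \<inter> \<Omega>)) (1 / q)
    \<le> escale C (epowr (cap_inner M p \<Omega>' E) (1 / p))"
  unfolding cap_inner_def
proof (rule bound_SUP_SUP[OF pq])
  fix F assume "F \<in> {F. compact F \<and> F \<subseteq> \<phi> -` E \<inter> \<Omega>}"
  then have F: "compact F" "F \<subseteq> \<phi> -` E \<inter> \<Omega>" by auto
  have "compact (\<phi> ` F)"
    using hom F continuous_on_subset[of \<Omega> \<phi> F]
    by (intro compact_continuous_image) (auto simp: homeomorphism_def)
  moreover have "\<phi> ` F \<subseteq> E" using F by auto
  moreover have "\<phi> -` (\<phi> ` F) \<inter> \<Omega> = F"
  proof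
    show "\<phi> -` (\<phi> ` F) \<inter> \<Omega> \<subseteq> F"
    proof
      fix x assume "x \<in> \<phi> -` (\<phi> ` F) \<inter> \<Omega>"
      then obtain z where "z \<in> F" "\<phi> x = \<phi> z" "x \<in> \<Omega>" by auto
      then show "x \<in> F" using hom F by (metis IntD2 homeomorphism_apply1 subsetD)
    qed
  qed (use F in auto)
  ultimately show "\<exists>F'\<in>{F. compact F \<and> F \<subseteq> E}. epowr (cap_compact M q \<Omega> F) (1 / q)
      \<le> escale C (epowr (cap_compact M p \<Omega>' F') (1 / p))"
    using cap_compact_vimage_le[OF M \<Omega> \<Omega>' pq C hom comp, of "\<phi> ` F"]
    by (intro bexI[of _ "\<phi> ` F"]) auto
qed

text \<open>The capacity of an open set is its inner capacity, and preimages of the open neighbourhoods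
  of \<open>E\<close> are competitors for the outer capacity of the preimage of \<open>E\<close>.\<close>

lemma cap_outer_vimage_le:
  assumes M: "doubling_space M" and \<Omega>: "bounded_domain \<Omega>" and \<Omega>': "bounded_domain \<Omega>'"
    and pq: "0 < p" "0 < q" and C: "0 \<le> C" and hom: "homeomorphism \<Omega> \<Omega>' \<phi> \<psi>"
    and comp: "bounded_composition M p q \<Omega> \<Omega>' \<phi> C"
  shows "epowr (cap_outer M q \<Omega> (\<phi> -` E \<inter> \<Omega>)) (1 / q)
    \<le> escale C (epowr (cap_outer M p \<Omega>' E) (1 / p))"
  unfolding cap_outer_def[of M p]
proof (rule bound_INF[OF pq(1) C])
  fix U assume U: "U \<in> {U. open U \<and> E \<subseteq> U \<and> U \<subseteq> \<Omega>'}"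
  have "continuous_on \<Omega> \<phi>" "open \<Omega>"
    using hom \<Omega> by (auto simp: homeomorphism_def bounded_domain_def)
  then have "open (\<phi> -` U \<inter> \<Omega>)"
    using U continuous_on_open_vimage[of \<Omega> \<phi>] by auto
  then have "cap_outer M q \<Omega> (\<phi> -` E \<inter> \<Omega>) \<le> cap_open M q \<Omega> (\<phi> -` U \<inter> \<Omega>)"
    unfolding cap_outer_def using U by (intro INF_lower) auto
  then have "epowr (cap_outer M q \<Omega> (\<phi> -` E \<inter> \<Omega>)) (1 / q)
      \<le> epowr (cap_open M q \<Omega> (\<phi> -` U \<inter> \<Omega>)) (1 / q)"
    using pq by (intro epowr_mono) auto
  also have "\<dots> \<le> escale C (epowr (cap_open M p \<Omega>' U) (1 / p))"
    using cap_inner_vimage_le[OF M \<Omega> \<Omega>' pq C hom comp, of U]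
    by (simp add: cap_open_def cap_inner_def)
  finally show "epowr (cap_outer M q \<Omega> (\<phi> -` E \<inter> \<Omega>)) (1 / q)
      \<le> escale C (epowr (cap_open M p \<Omega>' U) (1 / p))" .
qed

lemma cap_eq_cap_inner: "cap_measurable M p \<Omega> E \<Longrightarrow> cap M p \<Omega> E = cap_inner M p \<Omega> E"
  unfolding cap_def cap_measurable_def by auto

theorem theorem3p1:
  fixes M :: "'a::metric_space measure"
    and \<Omega> \<Omega>' E :: "'a set"
    and \<phi> :: "'a \<Rightarrow> 'a"
    and p q C :: real
  assumes "homogeneous_space M"
    and "supports_weak_Poincare M p"
    and "bounded_domain \<Omega>" and "bounded_domain \<Omega>'"
    and "1 < q" and "q \<le> p"
    and "bimeasurable_homeo M \<Omega> \<Omega>' \<phi>"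
    and "0 \<le> C"
    and "bounded_composition M p q \<Omega> \<Omega>' \<phi> C"
    and "E \<in> sets borel" and "E \<subseteq> \<Omega>'"
  shows "(cap_measurable M p \<Omega>' E \<and> cap_measurable M q \<Omega> (\<phi> -` E \<inter> \<Omega>) \<longrightarrow>
            epowr (cap M q \<Omega> (\<phi> -` E \<inter> \<Omega>)) (1 / q)
              \<le> escale C (epowr (cap M p \<Omega>' E) (1 / p))) \<and>
         epowr (cap_inner M q \<Omega> (\<phi> -` E \<inter> \<Omega>)) (1 / q)
           \<le> escale C (epowr (cap_inner M p \<Omega>' E) (1 / p)) \<and>
         epowr (cap_outer M q \<Omega> (\<phi> -` E \<inter> \<Omega>)) (1 / q)
           \<le> escale C (epowr (cap_outer M p \<Omega>' E) (1 / p))"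
proof -
  have M: "doubling_space M" using assms(1) by (simp add: homogeneous_space_def)
  obtain \<psi> where hom: "homeomorphism \<Omega> \<Omega>' \<phi> \<psi>"
    using assms(7) by (auto simp: bimeasurable_homeo_def)
  have pq: "0 < p" "0 < q" using assms(5,6) by auto
  note facts = M assms(3,4) pq assms(8) hom assms(9)
  show ?thesis
    using cap_inner_vimage_le[OF facts, of E] cap_outer_vimage_le[OF facts, of E]
    by (auto simp: cap_eq_cap_inner)
qed

end
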